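(* Let $X$ and $A$ be terms and $\Gamma$ a sequent. There exists a proof of $\Gamma \vdash A$ in $\mathbb{T}[\bar X]$ if and only if there exists a proof of $\Gamma \vdash A\otimes X^{\otimes m}$ in $\mathbb{T}$ for some integer $m\ge 0$.
   Context: Fix a countable set $\Phi$ of atomic propositions. Terms are generated from the elements of $\Phi$ and a constant $\mathbb{1}$ using a binary connective $\otimes$ (with parentheses). A sequent is a (possibly empty, not necessarily finite) multiset of terms; a comma denotes multiset union. An inference is an expression $\Gamma \vdash A$ with $\Gamma$ a sequent and $A$ a term. The system $\mathbb{T}$ has the following deduction rules. (Id) $P \vdash P$ for every atomic proposition $P\in\Phi$. (Cut) From $\Gamma \vdash B$ and $\Delta, B \vdash A$ deduce $\Delta,\Gamma \vdash A$, for any term $B$. (L-$\mathbb{1}$) From $\Gamma \vdash A$ deduce $\Gamma, \mathbb{1} \vdash A$. (R-$\mathbb{1}$) $\vdash \mathbb{1}$. (L-$\otimes$) From $A, B, \Gamma \vdash C$ deduce $A\otimes B, \Gamma \vdash C$. (R-$\otimes$) From $\Gamma \vdash A$ and $\Delta \vdash B$ deduce $\Gamma,\Delta \vdash A\otimes B$. (Exchange) Antecedent terms may be reordered arbitrarily (automatic when antecedents are multisets). A proof of an inference is a finite tree of rule applications with that inference as conclusion. For a term $X$, the system $\mathbb{T}[\bar X]$ has all the rules of $\mathbb{T}$ together with the rule (L-$X$): $X\vdash \mathbb{1}$ (no assumptions). $A\otimes X^{\otimes m}$ denotes $A$ tensored with $m$ copies of $X$ (equal to $A$ when $m=0$; the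 bracketing is immaterial for provability). *)

theory Defs
  imports Main "HOL-Library.Countable_Set" "HOL-Library.Extended_Nat"
    "HOL-Library.Function_Algebras"
begin

datatype (atoms: 'p) tm =
    Atom 'p
  | One (\<open>\<one>\<close>)
  | Tensor "'p tm" "'p tm" (infixl \<open>\<otimes>\<close> 70)

definition terms_over :: "'p set \<Rightarrow> 'p tm set" where
  "terms_over \<Phi> = {A. atoms A \<subseteq> \<Phi>}"

(* A multiset of terms is its multiplicity function. The library type 'a multiset only has
   finite multisets, whereas here infinitely many different terms may occur and a single term
   may occur infinitely often. Multiset union is pointwise addition, and the function 0 is the
   empty multiset. *)
type_synonym 'p sequent = "'p tm \<Rightarrow> enat"

definition single :: "'p tm \<Rightarrow> 'p sequent" where
  "single A = (\<lambda>B. if B = A then 1 else 0)"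

definition sequents_over :: "'p set \<Rightarrow> 'p sequent set" where
  "sequents_over \<Phi> = {\<Gamma>. \<forall>B. \<Gamma> B \<noteq> 0 \<longrightarrow> B \<in> terms_over \<Phi>}"

(* Provability over the atoms in \<Phi> from the rules of the system T together with the
   assumption-free rules listed in R. Requiring P to be in \<Phi> in rule Id is enough to keep all
   inferences in a proof within the language over \<Phi>, see provable_over below. *)
inductive provable ::
    "'p set \<Rightarrow> ('p sequent \<times> 'p tm) set \<Rightarrow> 'p sequent \<Rightarrow> 'p tm \<Rightarrow> bool"
  for \<Phi> :: "'p set" and R :: "('p sequent \<times> 'p tm) set" where
  Id: "P \<in> \<Phi> \<Longrightarrow> provable \<Phi> R (single (Atom P)) (Atom P)"
| Cut: "provable \<Phi> R \<Gamma> B \<Longrightarrow> provable \<Phi> R (\<Delta> + single B) A \<Longrightarrow> provable \<Phi> R (\<Delta> + \<Gamma>) A"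
| L_One: "provable \<Phi> R \<Gamma> A \<Longrightarrow> provable \<Phi> R (\<Gamma> + single \<one>) A"
| R_One: "provable \<Phi> R 0 \<one>"
| L_Tensor: "provable \<Phi> R (single A + single B + \<Gamma>) C \<Longrightarrow>
    provable \<Phi> R (single (A \<otimes> B) + \<Gamma>) C"
| R_Tensor: "provable \<Phi> R \<Gamma> A \<Longrightarrow> provable \<Phi> R \<Delta> B \<Longrightarrow> provable \<Phi> R (\<Gamma> + \<Delta>) (A \<otimes> B)"
| Extra: "(\<Gamma>, A) \<in> R \<Longrightarrow> provable \<Phi> R \<Gamma> A"

definition provable_T :: "'p set \<Rightarrow> 'p sequent \<Rightarrow> 'p tm \<Rightarrow> bool" where
  "provable_T \<Phi> = provable \<Phi> {}"

definition provable_T_bar :: "'p set \<Rightarrow> 'p tm \<Rightarrow> 'p sequent \<Rightarrow> 'p tm \<Rightarrow> bool" where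
  "provable_T_bar \<Phi> X = provable \<Phi> {(single X, \<one>)}"

(* tensor_copies A X m is (...((A \<otimes> X) \<otimes> X) ...) \<otimes> X with m copies of X. *)
primrec tensor_copies :: "'p tm \<Rightarrow> 'p tm \<Rightarrow> nat \<Rightarrow> 'p tm" where
  "tensor_copies A X 0 = A"
| "tensor_copies A X (Suc m) = tensor_copies A X m \<otimes> X"

lemma sequents_over_zero [simp]: "0 \<in> sequents_over \<Phi>"
  by (simp add: sequents_over_def)

lemma sequents_over_single [simp]: "single A \<in> sequents_over \<Phi> \<longleftrightarrow> A \<in> terms_over \<Phi>"
  by (auto simp: sequents_over_def single_def)

lemma sequents_over_plus [simp]:
  "\<Gamma> + \<Delta> \<in> sequents_over \<Phi> \<longleftrightarrow> \<Gamma> \<in> sequents_over \<Phi> \<and> \<Delta> \<in> sequents_over \<Phi>"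
  by (auto simp: sequents_over_def)

lemma terms_over_simps [simp]:
  "Atom P \<in> terms_over \<Phi> \<longleftrightarrow> P \<in> \<Phi>"
  "\<one> \<in> terms_over \<Phi>"
  "A \<otimes> B \<in> terms_over \<Phi> \<longleftrightarrow> A \<in> terms_over \<Phi> \<and> B \<in> terms_over \<Phi>"
  by (auto simp: terms_over_def)

lemma provable_over:
  assumes "provable \<Phi> R \<Gamma> A" and "R \<subseteq> sequents_over \<Phi> \<times> terms_over \<Phi>"
  shows "\<Gamma> \<in> sequents_over \<Phi> \<and> A \<in> terms_over \<Phi>"
  using assms by (induction rule: provable.induct) auto

end

theory Submission imports Defs begin

text \<open>From left to right, one collects the used instances of \<open>X \<turnstile> \<one>\<close> as spare factors
  \<open>X\<close> on the right: the rule itself becomes \<open>X \<turnstile> \<one> \<otimes> X\<close>, and spare factors of a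
  premise are carried through cuts and tensor introductions to the conclusion.
  From right to left, the spare factors are discarded by cutting against \<open>X \<turnstile> \<one>\<close>.\<close>

lemma tensor_copies_in_terms_over:
  assumes "tensor_copies A X m \<in> terms_over \<Phi>"
  shows "A \<in> terms_over \<Phi>"
  using assms by (induction m) auto

lemma provable_mono:
  assumes "provable \<Phi> R \<Gamma> A" and "R \<subseteq> S"
  shows "provable \<Phi> S \<Gamma> A"
  using assms(1)
proof (induction rule: provable.induct)
  case (Extra \<Gamma> A)
  then show ?case using assms(2) by (intro provable.Extra) auto
qed (rule provable.intros; assumption)+

text \<open>Rule \<open>Id\<close> covers atoms only. Identity on a compound term is built by
  introducing its connective on the right and then on the left.\<close>

lemma provable_refl:
  assumes "A \<in> terms_over \<Phi>"
  shows "provable \<Phi> R (single A) A"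
  using assms
proof (induction A)
  case (Atom P)
  then show ?case by (simp add: provable.Id)
next
  case One
  show ?case using provable.L_One [OF provable.R_One] by simp
next
  case (Tensor A B)
  then have "provable \<Phi> R (single A + single B + 0) (A \<otimes> B)"
    by (simp add: provable.R_Tensor)
  from provable.L_Tensor [OF this] show ?case by simp
qed

text \<open>Tensoring with the identity on \<open>X\<close> adds one factor to the right and one
  \<open>X\<close> to the left, which \<open>L_Tensor\<close> then absorbs into the copies around
  \<open>B\<close>. New factors go outermost, so the \<open>n\<close> existing ones stay in
  place.\<close>

lemma provable_add_copies:
  assumes "X \<in> terms_over \<Phi>" and "provable \<Phi> R (\<Delta> + single B) (tensor_copies A X n)"
  shows "provable \<Phi> R (\<Delta> + single (tensor_copies B X m)) (tensor_copies A X (n + m))"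
proof (induction m)
  case 0
  show ?case using assms(2) by (simp only: tensor_copies.simps add_0_right)
next
  case (Suc m)
  have "provable \<Phi> R (\<Delta> + single (tensor_copies B X m) + single X)
      (tensor_copies A X (n + m) \<otimes> X)"
    by (rule provable.R_Tensor [OF Suc.IH provable_refl [OF assms(1)]])
  then have "provable \<Phi> R (single (tensor_copies B X m) + single X + \<Delta>)
      (tensor_copies A X (n + Suc m))"
    by (simp add: ac_simps)
  from provable.L_Tensor [OF this] show ?case by (simp only: tensor_copies.simps add.commute [of _ \<Delta>])
qed

text \<open>This form of cut lets spare factors of the cut term pass to the conclusion, where those
  of both premises add up.\<close>

lemma provable_cut_copies:
  assumes "X \<in> terms_over \<Phi>" and "provable \<Phi> R \<Gamma> (tensor_copies B X m)"
    and "provable \<Phi> R (\<Delta> + single B) (tensor_copies A X n)"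
  shows "provable \<Phi> R (\<Delta> + \<Gamma>) (tensor_copies A X (n + m))"
  using assms(2) provable_add_copies [OF assms(1,3)] by (rule provable.Cut)

text \<open>A factor \<open>X\<close> on the left is traded for \<one>, which \<open>L_One\<close>
  supplies freely.\<close>

lemma provable_discard_copies:
  assumes "provable \<Phi> R (single X) \<one>" and "A \<in> terms_over \<Phi>"
  shows "provable \<Phi> R (single (tensor_copies A X m)) A"
proof (induction m)
  case 0
  show ?case using assms(2) by (simp add: provable_refl)
next
  case (Suc m)
  have "provable \<Phi> R (single (tensor_copies A X m) + single X) A"
    by (rule provable.Cut [OF assms(1) provable.L_One [OF Suc.IH]])
  then have "provable \<Phi> R (single (tensor_copies A X m) + single X + 0) A" by simp
  from provable.L_Tensor [OF this] show ?case by simp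
qed

lemma provable_T_if_provable_T_bar:
  assumes "provable \<Phi> {(single X, \<one>)} \<Gamma> A" and X: "X \<in> terms_over \<Phi>"
  shows "\<exists>m. provable \<Phi> {} \<Gamma> (tensor_copies A X m)"
  using assms(1)
proof (induction rule: provable.induct)
  case (Id P)
  then have "provable \<Phi> {} (single (Atom P)) (tensor_copies (Atom P) X 0)"
    by (simp add: provable.Id)
  then show ?case ..
next
  case (Cut \<Gamma> B \<Delta> A)
  then obtain m n where "provable \<Phi> {} \<Gamma> (tensor_copies B X m)"
    and "provable \<Phi> {} (\<Delta> + single B) (tensor_copies A X n)" by (elim exE) (rule that)
  from provable_cut_copies [OF X this] show ?case ..
next
  case (L_One \<Gamma> A)
  \<comment> \<open>Left rules do not touch the succedent, so the same number of copies
    works.\<close>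
  from L_One.IH show ?case by (elim exE) (rule exI, rule provable.L_One)
next
  case R_One
  have "provable \<Phi> {} 0 (tensor_copies \<one> X 0)" by (simp add: provable.R_One)
  then show ?case ..
next
  case (L_Tensor A B \<Gamma> C)
  from L_Tensor.IH show ?case by (elim exE) (rule exI, rule provable.L_Tensor)
next
  case (R_Tensor \<Gamma> A \<Delta> B)
  then obtain m n where A: "provable \<Phi> {} \<Gamma> (tensor_copies A X m)"
    and B: "provable \<Phi> {} \<Delta> (tensor_copies B X n)" by blast
  \<comment> \<open>Identity on \<open>A\<close> and \<open>B\<close> needs them to lie in the
    language; this is recovered from their provability.\<close>
  have "A \<in> terms_over \<Phi>" "B \<in> terms_over \<Phi>"
    using provable_over [OF A] provable_over [OF B] by (auto dest: tensor_copies_in_terms_over)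
  then have "provable \<Phi> {} (single A + single B) (tensor_copies (A \<otimes> B) X 0)"
    by (simp add: provable.R_Tensor provable_refl)
  \<comment> \<open>Cutting \<open>A, B\<close> out of the antecedent one after the other collects
    all spare factors outside \<open>A \<otimes> B\<close>, with no rebracketing.\<close>
  from provable_cut_copies [OF X B this]
  have "provable \<Phi> {} (\<Delta> + single A) (tensor_copies (A \<otimes> B) X n)"
    by (simp only: add.commute [of "single A"] add_0_left)
  from provable_cut_copies [OF X A this] show ?case
    by (simp only: add.commute [of \<Delta>]) (rule exI)
next
  case (Extra \<Gamma> A)
  \<comment> \<open>Each use of the extra axiom costs exactly one spare factor.\<close>
  have "provable \<Phi> {} (0 + single X) (\<one> \<otimes> X)"
    by (rule provable.R_Tensor [OF provable.R_One provable_refl [OF X]])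
  then have "provable \<Phi> {} \<Gamma> (tensor_copies A X 1)"
    using Extra by simp
  then show ?case ..
qed

theorem proposition15:
  fixes \<Phi> :: "'p set" and X A :: "'p tm" and \<Gamma> :: "'p sequent"
  assumes "countable \<Phi>"
    and "X \<in> terms_over \<Phi>" and "A \<in> terms_over \<Phi>" and "\<Gamma> \<in> sequents_over \<Phi>"
  shows "provable_T_bar \<Phi> X \<Gamma> A \<longleftrightarrow> (\<exists>m::nat. provable_T \<Phi> \<Gamma> (tensor_copies A X m))"
proof
  assume "provable_T_bar \<Phi> X \<Gamma> A"
  then show "\<exists>m. provable_T \<Phi> \<Gamma> (tensor_copies A X m)"
    unfolding provable_T_def provable_T_bar_def
    using assms(2) by (rule provable_T_if_provable_T_bar)
next
  let ?R = "{(single X, \<one>)}"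
  assume "\<exists>m. provable_T \<Phi> \<Gamma> (tensor_copies A X m)"
  then obtain m where "provable \<Phi> {} \<Gamma> (tensor_copies A X m)"
    unfolding provable_T_def ..
  then have "provable \<Phi> ?R \<Gamma> (tensor_copies A X m)"
    by (rule provable_mono) simp
  moreover have "provable \<Phi> ?R (single X) \<one>"
    by (rule provable.Extra) simp
  \<comment> \<open>The empty context \<open>0\<close> gives the antecedent the shape that
    \<open>Cut\<close> expects.\<close>
  then have "provable \<Phi> ?R (0 + single (tensor_copies A X m)) A"
    using provable_discard_copies assms(3) by (simp only: add_0_left)
  ultimately have "provable \<Phi> ?R (0 + \<Gamma>) A"
    by (rule provable.Cut)
  then show "provable_T_bar \<Phi> X \<Gamma> A"
    by (simp add: provable_T_bar_def)
qed

end
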